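(* Let $\Gamma = \langle \rho_0,\ldots,\rho_{r-1}\rangle$ be an even permutation group that is a glued sggi with string C pieces, with parameters $r$, $m$ (as defined in the context). Suppose that: (1) for all $1 \leq i \leq m-2$, $\langle \rho_0, \ldots, \rho_{m-1}\rangle \cap \langle \rho_i, \ldots, \rho_{r-1}\rangle = \langle \rho_i, \ldots, \rho_{m-1}\rangle$; and (2) for all $m+1 \leq j \leq r-2$, $\langle \rho_m, \ldots, \rho_{r-1}\rangle \cap \langle \rho_0, \ldots, \rho_j\rangle = \langle \rho_m, \ldots, \rho_j\rangle$. Then $\Gamma$ is a string C-group.
   Context: A rank $r$ sggi is a group $\Gamma = \langle \rho_0, \ldots, \rho_{r-1}\rangle$ with a distinguished ordered tuple of generators satisfying $\rho_i^2 = 1$ for all $i$ and $(\rho_i\rho_j)^2 = 1$ whenever $|i-j| \geq 2$. It is a string C-group if $\langle \rho_i \mid i \in I\rangle \cap \langle \rho_j \mid j \in J\rangle = \langle \rho_k \mid k \in I\cap J\rangle$ for all $I, J \subseteq \{0,\ldots,r-1\}$. If $\Gamma$ is a permutation group on a finite set $\Omega$, its permutation representation graph is the edge-labeled multigraph with vertex set $\Omega$ with an edge labeled $i$ joining $x \neq y$ exactly when $x\rho_i = y$. A permutation group is even if all of its elements are even permutations. Glued sggi: $\Gamma$ is an sggi of rank $r$, acting as a permutation group on a finite set, whose permutation representation graph $G$ consists of (is the union of) subgraphs $H_1$ and $H_2$ with at least two vertices each, sharing a single vertex $v$, where the edge labels in $H_1$ are between $0$ and $m-1$ and the edge labels in $H_2$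 are between $m$ and $r-1$ (with $m<r$); furthermore $v$ is adjacent to at least one other vertex in $H_1$ and to at least one other vertex in $H_2$. Glued sggi with string C pieces: a glued sggi for which, in addition, $\langle \rho_0,\ldots,\rho_{m-1}\rangle$ and $\langle \rho_m,\ldots,\rho_{r-1}\rangle$ are string C-groups. *)

theory Defs
  imports "HOL-Combinatorics.Permutations" "HOL-Algebra.Elementary_Groups"
begin

section \<open>String groups generated by involutions and string C-groups\<close>

text \<open>The distinguished generators \<open>\<rho>\<^sub>0, \<dots>, \<rho>\<^sub>r\<^sub>-\<^sub>1\<close> are a function
  \<open>\<rho>\<close> on the naturals, of which only the values at \<open>i < r\<close> are relevant. As usual for these
  groups, \<open>\<rho>\<^sub>i = 1\<close> is not excluded.\<close>

definition sggi :: "('g, 'b) monoid_scheme \<Rightarrow> nat \<Rightarrow> (nat \<Rightarrow> 'g) \<Rightarrow> bool" where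
  "sggi G r \<rho> \<longleftrightarrow>
     group G \<and>
     \<rho> ` {..<r} \<subseteq> carrier G \<and>
     carrier G = generate G (\<rho> ` {..<r}) \<and>
     (\<forall>i<r. \<rho> i [^]\<^bsub>G\<^esub> (2::nat) = \<one>\<^bsub>G\<^esub>) \<and>
     (\<forall>i<r. \<forall>j<r. \<bar>int i - int j\<bar> \<ge> 2 \<longrightarrow> (\<rho> i \<otimes>\<^bsub>G\<^esub> \<rho> j) [^]\<^bsub>G\<^esub> (2::nat) = \<one>\<^bsub>G\<^esub>)"

definition string_C_group :: "('g, 'b) monoid_scheme \<Rightarrow> nat \<Rightarrow> (nat \<Rightarrow> 'g) \<Rightarrow> bool" where
  "string_C_group G r \<rho> \<longleftrightarrow>
     sggi G r \<rho> \<and>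
     (\<forall>I J. I \<subseteq> {..<r} \<longrightarrow> J \<subseteq> {..<r} \<longrightarrow>
        generate G (\<rho> ` I) \<inter> generate G (\<rho> ` J) = generate G (\<rho> ` (I \<inter> J)))"

section \<open>Permutation groups\<close>

text \<open>Permutations of \<open>\<Omega>\<close> are functions that are the identity outside \<open>\<Omega>\<close>. They are composed
  as functions, whereas \<open>x\<rho>\<^sub>i\<close> suggests the opposite product; passing to the opposite group
  changes neither the subgroups \<open>\<langle>\<rho>\<^sub>i | i \<in> I\<rangle>\<close> as sets of permutations nor the defining
  relations of an sggi.\<close>

definition symmetric_group :: "'a set \<Rightarrow> ('a \<Rightarrow> 'a) monoid" where
  "symmetric_group \<Omega> = \<lparr>carrier = {p. p permutes \<Omega>}, monoid.mult = (\<circ>), one = id\<rparr>"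

definition permutation_group :: "'a set \<Rightarrow> ('a \<Rightarrow> 'a) monoid \<Rightarrow> bool" where
  "permutation_group \<Omega> \<Gamma> \<longleftrightarrow>
     finite \<Omega> \<and> (\<exists>H. subgroup H (symmetric_group \<Omega>) \<and> \<Gamma> = (symmetric_group \<Omega>)\<lparr>carrier := H\<rparr>)"

definition even_permutation_group :: "'a set \<Rightarrow> ('a \<Rightarrow> 'a) monoid \<Rightarrow> bool" where
  "even_permutation_group \<Omega> \<Gamma> \<longleftrightarrow> permutation_group \<Omega> \<Gamma> \<and> (\<forall>p\<in>carrier \<Gamma>. evenperm p)"

lemma group_symmetric_group: "group (symmetric_group \<Omega>)"
proof (rule groupI)
  fix p assume "p \<in> carrier (symmetric_group \<Omega>)"
  then show "\<exists>q\<in>carrier (symmetric_group \<Omega>). q \<otimes>\<^bsub>symmetric_group \<Omega>\<^esub> p = \<one>\<^bsub>symmetric_group \<Omega>\<^esub>"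
    by (auto simp: symmetric_group_def intro!: exI[of _ "inv_into UNIV p"] permutes_inv permutes_inv_o)
qed (auto simp: symmetric_group_def permutes_compose permutes_id o_assoc)

section \<open>Permutation representation graphs\<close>

text \<open>An edge is a pair of its set of endpoints and its label, so parallel edges with different
  labels are distinct.\<close>

record 'a labeled_multigraph =
  verts :: "'a set"
  edges :: "('a set \<times> nat) set"

definition perm_rep_graph :: "'a set \<Rightarrow> nat \<Rightarrow> (nat \<Rightarrow> 'a \<Rightarrow> 'a) \<Rightarrow> 'a labeled_multigraph" where
  "perm_rep_graph \<Omega> r \<rho> =
     \<lparr>verts = \<Omega>,
      edges = {({x, y}, i) | x y i. x \<in> \<Omega> \<and> y \<in> \<Omega> \<and> i < r \<and> x \<noteq> y \<and> \<rho> i x = y}\<rparr>"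

definition is_subgraph :: "'a labeled_multigraph \<Rightarrow> 'a labeled_multigraph \<Rightarrow> bool" where
  "is_subgraph H G \<longleftrightarrow>
     verts H \<subseteq> verts G \<and> edges H \<subseteq> edges G \<and> (\<forall>(e, i)\<in>edges H. e \<subseteq> verts H)"

definition graph_union ::
    "'a labeled_multigraph \<Rightarrow> 'a labeled_multigraph \<Rightarrow> 'a labeled_multigraph" where
  "graph_union H\<^sub>1 H\<^sub>2 = \<lparr>verts = verts H\<^sub>1 \<union> verts H\<^sub>2, edges = edges H\<^sub>1 \<union> edges H\<^sub>2\<rparr>"

definition adjacent :: "'a labeled_multigraph \<Rightarrow> 'a \<Rightarrow> 'a \<Rightarrow> bool" where
  "adjacent H x y \<longleftrightarrow> (\<exists>i. ({x, y}, i) \<in> edges H)"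

section \<open>Glued sggis\<close>

definition glued_sggi ::
    "'a set \<Rightarrow> ('a \<Rightarrow> 'a) monoid \<Rightarrow> nat \<Rightarrow> nat \<Rightarrow> (nat \<Rightarrow> 'a \<Rightarrow> 'a) \<Rightarrow> bool" where
  "glued_sggi \<Omega> \<Gamma> r m \<rho> \<longleftrightarrow>
     permutation_group \<Omega> \<Gamma> \<and> sggi \<Gamma> r \<rho> \<and> m < r \<and>
     (\<exists>H\<^sub>1 H\<^sub>2 v.
        is_subgraph H\<^sub>1 (perm_rep_graph \<Omega> r \<rho>) \<and>
        is_subgraph H\<^sub>2 (perm_rep_graph \<Omega> r \<rho>) \<and>
        perm_rep_graph \<Omega> r \<rho> = graph_union H\<^sub>1 H\<^sub>2 \<and>
        card (verts H\<^sub>1) \<ge> 2 \<and> card (verts H\<^sub>2) \<ge> 2 \<and>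
        verts H\<^sub>1 \<inter> verts H\<^sub>2 = {v} \<and>
        (\<forall>(e, i)\<in>edges H\<^sub>1. i < m) \<and>
        (\<forall>(e, i)\<in>edges H\<^sub>2. m \<le> i \<and> i < r) \<and>
        (\<exists>w\<in>verts H\<^sub>1. w \<noteq> v \<and> adjacent H\<^sub>1 v w) \<and>
        (\<exists>w\<in>verts H\<^sub>2. w \<noteq> v \<and> adjacent H\<^sub>2 v w))"

text \<open>The second piece has rank \<open>r - m\<close>; its generators \<open>\<rho>\<^sub>m, \<dots>, \<rho>\<^sub>r\<^sub>-\<^sub>1\<close> are
  re-indexed to start at \<open>0\<close>.\<close>

definition glued_sggi_string_C_pieces ::
    "'a set \<Rightarrow> ('a \<Rightarrow> 'a) monoid \<Rightarrow> nat \<Rightarrow> nat \<Rightarrow> (nat \<Rightarrow> 'a \<Rightarrow> 'a) \<Rightarrow> bool" where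
  "glued_sggi_string_C_pieces \<Omega> \<Gamma> r m \<rho> \<longleftrightarrow>
     glued_sggi \<Omega> \<Gamma> r m \<rho> \<and>
     string_C_group (subgroup_generated \<Gamma> (\<rho> ` {..<m})) m \<rho> \<and>
     string_C_group (subgroup_generated \<Gamma> (\<rho> ` {m..<r})) (r - m) (\<lambda>i. \<rho> (m + i))"

end

theory Submission
  imports Defs
begin

text \<open>A string group is a string C-group as soon as
  \<open>\<langle>\<rho>\<^sub>a, \<dots>, \<rho>\<^sub>b\<^sub>-\<^sub>1\<rangle> \<inter> \<langle>\<rho>\<^sub>a\<^sub>+\<^sub>1, \<dots>, \<rho>\<^sub>b\<rangle> = \<langle>\<rho>\<^sub>a\<^sub>+\<^sub>1, \<dots>, \<rho>\<^sub>b\<^sub>-\<^sub>1\<rangle>\<close> for all \<open>a < b < r\<close>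
  (\<open>string_C_groupI\<close>). If \<open>b < m\<close> or \<open>m \<le> a\<close>, this is part of the intersection property of one of the
  two pieces.

  Let \<open>a < m \<le> b\<close>. Write \<open>V\<close> and \<open>V'\<close> for the vertex sets of the two subgraphs. Generators on different
  sides with non-consecutive labels commute, which is impossible if both move the common vertex \<open>v\<close>;
  hence \<open>\<rho>\<^sub>m\<^sub>-\<^sub>1\<close> and \<open>\<rho>\<^sub>m\<close> are the only generators that move \<open>v\<close> (\<open>glued_sggiE\<close>). The supports of
  these two involutions meet only in \<open>v\<close>, so \<open>(\<rho>\<^sub>m\<^sub>-\<^sub>1 \<rho>\<^sub>m)\<^sup>2\<close> is a 3-cycle on \<open>v\<close> and its two images.

  Suppose that \<open>a + 1 < m < b\<close>, and let \<open>C = \<langle>\<rho>\<^sub>a\<^sub>+\<^sub>1, \<dots>, \<rho>\<^sub>b\<^sub>-\<^sub>1\<rangle>\<close>. Then \<open>C\<close> contains this 3-cycle, and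
  therefore all even permutations of the orbit \<open>\<Delta>\<close> of \<open>v\<close> under \<open>C\<close> (\<open>alternating_on_orbit\<close>). Let \<open>g\<close> lie in both
  outer groups. On \<open>V' - \<Delta>\<close> the generators of one outer group act like those of
  \<open>\<langle>\<rho>\<^sub>m, \<dots>, \<rho>\<^sub>b\<^sub>-\<^sub>1\<rangle>\<close>, and on \<open>V - \<Delta>\<close> those of the other one act like
  \<open>\<langle>\<rho>\<^sub>a\<^sub>+\<^sub>1, \<dots>, \<rho>\<^sub>m\<^sub>-\<^sub>1\<rangle>\<close>. Dividing \<open>g\<close> by one element of each of these subgroups of \<open>C\<close> leaves an even
  permutation of \<open>\<Delta>\<close>, which lies in \<open>C\<close> (\<open>glue_intersection\<close>).

  The cases \<open>a = m - 1\<close> and \<open>b = m\<close> are those where \<open>C\<close> lies in a single piece. There the hypotheses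
  (1) and (2) apply, unless \<open>C\<close> has at most one generator. If it has none, an element of both outer
  groups can move only \<open>v\<close>, so it is the identity. If \<open>C\<close> is generated by \<open>\<rho>\<^sub>m\<close> or \<open>\<rho>\<^sub>m\<^sub>-\<^sub>1\<close> alone, evenness
  decides again, since the only even permutation of two points is the identity
  (\<open>hinge_intersection\<close>).\<close>

section \<open>Reduction of the intersection property to intervals\<close>

context group
begin

lemma generate_Un_commuting:
  assumes H: "H \<subseteq> carrier G" and K: "K \<subseteq> carrier G"
    and comm: "\<And>h k. h \<in> H \<Longrightarrow> k \<in> K \<Longrightarrow> h \<otimes> k = k \<otimes> h"
    and g: "g \<in> generate G (H \<union> K)"
  obtains x y where "x \<in> generate G H" "y \<in> generate G K" "g = x \<otimes> y"
proof -
  (* Two centralizer arguments extend the commutation from the generators to the groups. *)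
  have sub: "subgroup {x \<in> carrier G. \<forall>h\<in>M. x \<otimes> h = h \<otimes> x} G" if M: "M \<subseteq> carrier G" for M
  proof (rule subgroupI)
    fix x assume x: "x \<in> {x \<in> carrier G. \<forall>h\<in>M. x \<otimes> h = h \<otimes> x}"
    have "inv x \<otimes> h = h \<otimes> inv x" if "h \<in> M" for h
      using x that M by (intro inv_solve_left' inv_solve_right' | auto simp: subset_iff m_assoc
            inv_solve_left inv_solve_right)+
    then show "inv x \<in> {x \<in> carrier G. \<forall>h\<in>M. x \<otimes> h = h \<otimes> x}"
      using x by auto
  next
    fix x y
    assume "x \<in> {x \<in> carrier G. \<forall>h\<in>M. x \<otimes> h = h \<otimes> x}"
      and "y \<in> {x \<in> carrier G. \<forall>h\<in>M. x \<otimes> h = h \<otimes> x}"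
    then show "x \<otimes> y \<in> {x \<in> carrier G. \<forall>h\<in>M. x \<otimes> h = h \<otimes> x}"
      using M by (auto simp: subset_iff m_assoc) (metis m_assoc)
  qed (use M in \<open>auto intro!: exI[of _ \<one>]\<close>)
  have "generate G K \<subseteq> {x \<in> carrier G. \<forall>h\<in>H. x \<otimes> h = h \<otimes> x}"
    by (rule generate_subgroup_incl[OF _ sub[OF H]]) (use K comm in auto)
  then have "generate G H \<subseteq> {x \<in> carrier G. \<forall>k\<in>generate G K. x \<otimes> k = k \<otimes> x}"
    by (intro generate_subgroup_incl[OF _ sub[OF generate_incl[OF K]]]) (use H in auto)
  then have c: "x \<otimes> y = y \<otimes> x" if "x \<in> generate G H" "y \<in> generate G K" for x y
    using that by auto
  have inH: "x \<in> carrier G" if "x \<in> generate G H" for x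
    using that H generate_in_carrier by auto
  have inK: "x \<in> carrier G" if "x \<in> generate G K" for x
    using that K generate_in_carrier by auto
  have "\<exists>x\<in>generate G H. \<exists>y\<in>generate G K. g = x \<otimes> y"
    using g
  proof (induction rule: generate.induct)
    case one
    show ?case by (intro bexI[of _ \<one>]) (auto intro: generate.one)
  next
    case (incl h)
    then consider "h \<in> H" | "h \<in> K" by blast
    then show ?case
    proof cases
      case 1
      then show ?thesis using H
        by (intro bexI[of _ h] bexI[of _ \<one>]) (auto intro: generate.intros)
    next
      case 2
      then show ?thesis using K
        by (intro bexI[of _ h] bexI[of _ \<one>]) (auto intro: generate.intros)
    qed
  next
    case (inv h)
    then consider "h \<in> H" | "h \<in> K" by blast
    then show ?case
    proof cases
      case 1
      then show ?thesis using H
        by (intro bexI[of _ "inv h"] bexI[of _ \<one>]) (auto intro: generate.intros)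
    next
      case 2
      then show ?thesis using K
        by (intro bexI[of _ "inv h"] bexI[of _ \<one>]) (auto intro: generate.intros)
    qed
  next
    case (eng g1 g2)
    then obtain x1 y1 x2 y2 where *: "x1 \<in> generate G H" "y1 \<in> generate G K" "g1 = x1 \<otimes> y1"
        "x2 \<in> generate G H" "y2 \<in> generate G K" "g2 = x2 \<otimes> y2"
      by blast
    have "g1 \<otimes> g2 = x1 \<otimes> (y1 \<otimes> x2) \<otimes> y2"
      using * inH inK by (simp add: m_assoc)
    also have "\<dots> = x1 \<otimes> (x2 \<otimes> y1) \<otimes> y2"
      using c[of x2 y1] * by simp
    also have "\<dots> = (x1 \<otimes> x2) \<otimes> (y1 \<otimes> y2)"
      using * inH inK by (simp add: m_assoc)
    finally show ?case
      using * by (blast intro: generate.eng)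
  qed
  then show ?thesis using that by blast
qed

end

lemma sggi_involution:
  fixes G (structure)
  assumes "sggi G r \<rho>" "i < r"
  shows "\<rho> i \<in> carrier G" "\<rho> i \<otimes> \<rho> i = \<one>"
proof -
  interpret group G using assms by (simp add: sggi_def)
  show c: "\<rho> i \<in> carrier G" using assms by (auto simp: sggi_def)
  have "\<rho> i [^] (2::nat) = \<one>" using assms by (auto simp: sggi_def)
  then show "\<rho> i \<otimes> \<rho> i = \<one>" using c by (simp add: numeral_2_eq_2)
qed

lemma sggi_commute:
  fixes G (structure)
  assumes s: "sggi G r \<rho>" and "i < r" "j < r" "i + 2 \<le> j \<or> j + 2 \<le> i"
  shows "\<rho> i \<otimes> \<rho> j = \<rho> j \<otimes> \<rho> i"
proof -
  interpret group G using assms by (simp add: sggi_def)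
  note i = sggi_involution[OF s \<open>i < r\<close>] and j = sggi_involution[OF s \<open>j < r\<close>]
  have "\<bar>int i - int j\<bar> \<ge> 2" using assms(4) by auto
  then have "(\<rho> i \<otimes> \<rho> j) [^] (2::nat) = \<one>"
    using assms by (auto simp: sggi_def)
  then have "(\<rho> i \<otimes> \<rho> j) \<otimes> (\<rho> i \<otimes> \<rho> j) = \<one>"
    using i j by (simp add: numeral_2_eq_2)
  then have "inv (\<rho> i \<otimes> \<rho> j) = \<rho> i \<otimes> \<rho> j"
    using i j by (intro inv_equality) auto
  moreover have "inv (\<rho> i) = \<rho> i" "inv (\<rho> j) = \<rho> j"
    using i j by (auto intro: inv_equality)
  ultimately show ?thesis
    using i j by (simp add: inv_mult_group)
qed

text \<open>The intersection of two overlapping intervals is reached by shrinking: an element of both groups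
  also lies in the groups of the long intervals from \<open>a\<close> to \<open>d - 1\<close> and from \<open>a + 1\<close> to \<open>d\<close>, so
  the hypothesis removes both ends at once, and what remains are two pairs of intervals that are
  closer to being nested. Empty intervals are included, and then the intersection is trivial.\<close>

lemma (in group) interval_intersection:
  fixes \<rho> :: "nat \<Rightarrow> 'a"
  assumes facet: "\<And>a b. a < b \<Longrightarrow> b < r \<Longrightarrow>
      generate G (\<rho> ` {a..<b}) \<inter> generate G (\<rho> ` {Suc a..<Suc b})
        \<subseteq> generate G (\<rho> ` {Suc a..<b})"
    and "a \<le> c" "b \<le> d" "d \<le> r"
  shows "generate G (\<rho> ` {a..<b}) \<inter> generate G (\<rho> ` {c..<d}) \<subseteq> generate G (\<rho> ` {c..<b})"
  using assms(2-4)
proof (induction "(c - a) + (d - b)" arbitrary: a b c d rule: less_induct)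
  case less
  have mono: "generate G (\<rho> ` {x..<y}) \<subseteq> generate G (\<rho> ` {x'..<y'})" if "x' \<le> x" "y \<le> y'"
    for x y x' y'
    using that by (intro mono_generate image_mono) auto
  show ?case
  proof (cases "a = c \<or> b = d \<or> b \<le> a")
    case True
    moreover have "generate G (\<rho> ` {a..<b}) \<subseteq> generate G (\<rho> ` {c..<b})" if "b \<le> a"
      using that by (intro mono_generate) auto
    ultimately show ?thesis by auto
  next
    case False
    then have lt: "a < c" "b < d" "a < d - 1" "b \<le> d - 1" "d - 1 < r" using less.prems by auto
    show ?thesis
    proof
      fix g assume "g \<in> generate G (\<rho> ` {a..<b}) \<inter> generate G (\<rho> ` {c..<d})"
      then have g: "g \<in> generate G (\<rho> ` {a..<b})" "g \<in> generate G (\<rho> ` {c..<d})"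
        by auto
      have "g \<in> generate G (\<rho> ` {a..<d - 1})" "g \<in> generate G (\<rho> ` {Suc a..<Suc (d - 1)})"
        using g mono[of a a b "d - 1"] mono[of "Suc a" c d "Suc (d - 1)"] lt by auto
      with facet[of a "d - 1"] have "g \<in> generate G (\<rho> ` {Suc a..<d - 1})"
        using lt less.prems by auto
      moreover have "generate G (\<rho> ` {a..<b}) \<inter> generate G (\<rho> ` {Suc a..<d - 1})
          \<subseteq> generate G (\<rho> ` {Suc a..<b})"
        by (rule less.hyps) (use lt less.prems in linarith)+
      moreover have "generate G (\<rho> ` {Suc a..<b}) \<inter> generate G (\<rho> ` {c..<d})
          \<subseteq> generate G (\<rho> ` {c..<b})"
        by (rule less.hyps) (use lt less.prems in linarith)+
      ultimately show "g \<in> generate G (\<rho> ` {c..<b})"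
        using g by blast
    qed
  qed
qed

text \<open>To pass from intervals to arbitrary sets \<open>I\<close> and \<open>J\<close>, it is enough to remove from \<open>I\<close> one label
  \<open>j \<notin> J\<close> at a time, and for this \<open>J\<close> may be enlarged to the set of all labels except \<open>j\<close>. The
  maximal run of consecutive labels of \<open>I\<close> through \<open>j\<close> commutes with the rest of \<open>I\<close>, which avoids
  \<open>j\<close> anyway; so \<open>I\<close> may be replaced with the run, and the labels below \<open>j\<close> commute with
  those above \<open>j\<close>. Then only intersections of intervals remain.\<close>

theorem string_C_groupI:
  fixes G (structure)
  assumes s: "sggi G r \<rho>"
    and facet: "\<And>a b. a < b \<Longrightarrow> b < r \<Longrightarrow>
      generate G (\<rho> ` {a..<b}) \<inter> generate G (\<rho> ` {Suc a..<Suc b})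
        \<subseteq> generate G (\<rho> ` {Suc a..<b})"
  shows "string_C_group G r \<rho>"
proof -
  interpret group G using s by (simp add: sggi_def)
  define gen where "gen I = generate G (\<rho> ` I)" for I
  have gen_mono: "gen I \<subseteq> gen J" if "I \<subseteq> J" for I J
    unfolding gen_def using that by (intro mono_generate image_mono)
  have img: "\<rho> ` I \<subseteq> carrier G" if "I \<subseteq> {..<r}" for I
    using that sggi_involution(1)[OF s] by auto
  have gen_sub: "subgroup (gen I) G" if "I \<subseteq> {..<r}" for I
    unfolding gen_def by (rule generate_is_subgroup[OF img[OF that]])
  have carr: "x \<in> carrier G" if "I \<subseteq> {..<r}" "x \<in> gen I" for x I
    using gen_sub[OF that(1)] that(2) by (rule subgroup.mem_carrier)
  have intervals: "gen {a..<b} \<inter> gen {c..<d} \<subseteq> gen {c..<b}" if "a \<le> c" "b \<le> d" "d \<le> r" for a b c d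
    unfolding gen_def by (rule interval_intersection[OF facet that])
  have split: "\<exists>x\<in>gen I. \<exists>y\<in>gen J. g = x \<otimes> y"
    if IJ: "I \<union> J \<subseteq> {..<r}" "\<And>i j. i \<in> I \<Longrightarrow> j \<in> J \<Longrightarrow> i + 2 \<le> j \<or> j + 2 \<le> i"
      and g: "g \<in> gen (I \<union> J)" for I J g
  proof -
    have "g \<in> generate G (\<rho> ` I \<union> \<rho> ` J)" using g by (simp add: gen_def image_Un)
    moreover have "\<rho> ` I \<subseteq> carrier G" "\<rho> ` J \<subseteq> carrier G"
      using IJ(1) img[of I] img[of J] by auto
    moreover have "h \<otimes> k = k \<otimes> h" if "h \<in> \<rho> ` I" "k \<in> \<rho> ` J" for h k
    proof -
      from that obtain i j where "i \<in> I" "h = \<rho> i" "j \<in> J" "k = \<rho> j" by blast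
      then show ?thesis using IJ sggi_commute[OF s, of i j] by blast
    qed
    ultimately obtain x y where "x \<in> gen I" "y \<in> gen J" "g = x \<otimes> y"
      unfolding gen_def using generate_Un_commuting[of "\<rho> ` I" "\<rho> ` J" g] by metis
    then show ?thesis by blast
  qed
  have delete: "gen I \<inter> gen ({..<r} - {j}) \<subseteq> gen (I - {j})" if I: "I \<subseteq> {..<r}" and j: "j \<in> I" for I j
  proof
    fix g assume "g \<in> gen I \<inter> gen ({..<r} - {j})"
    then have g: "g \<in> gen I" "g \<in> gen ({..<r} - {j})" by auto
    (* The run of consecutive labels of I through j is {p..<q}. *)
    define p where "p = (LEAST p. {p..j} \<subseteq> I)"
    define q where "q = (LEAST q. j < q \<and> q \<notin> I)"
    have p: "{p..j} \<subseteq> I" unfolding p_def by (rule LeastI[of _ j]) (use j in auto)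
    have pmin: "\<not> {p'..j} \<subseteq> I" if "p' < p" for p'
      using that not_less_Least unfolding p_def by blast
    have jr: "j < r" using I j by auto
    have q: "j < q \<and> q \<notin> I" unfolding q_def by (rule LeastI[of _ r]) (use I jr in auto)
    have qmin: "x \<in> I" if "j < x" "x < q" for x
      using that not_less_Least unfolding q_def by blast
    have pj: "p \<le> j" unfolding p_def by (rule Least_le) (use j in auto)
    have qr: "q \<le> r" unfolding q_def by (rule Least_le) (use I jr in auto)
    have run: "{p..<q} \<subseteq> I"
    proof
      fix x assume "x \<in> {p..<q}"
      then show "x \<in> I" using p qmin[of x] by (cases "j < x") auto
    qed
    have below: "Suc i \<noteq> p" if "i \<in> I" for i
    proof
      assume eq: "Suc i = p"
      have "x \<in> I" if "x \<in> {i..j}" for x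
        using that p \<open>i \<in> I\<close> eq by (cases "x = i") auto
      with pmin[of i] eq show False by blast
    qed
    define R where "R = I - {p..<q}"
    have IR: "I = {p..<q} \<union> R" using run by (auto simp: R_def)
    have jR: "j \<notin> R" "R \<subseteq> {..<r}" using pj q I by (auto simp: R_def)
    have far: "x + 2 \<le> i \<or> i + 2 \<le> x" if "x \<in> {p..<q}" "i \<in> R" for x i
    proof -
      have "i \<in> I" "i < p \<or> q \<le> i" using that by (auto simp: R_def)
      moreover have "i \<noteq> q" using q \<open>i \<in> I\<close> by auto
      ultimately show ?thesis using below[of i] that by auto
    qed
    obtain \<mu> \<nu> where mn: "\<mu> \<in> gen {p..<q}" "\<nu> \<in> gen R" "g = \<mu> \<otimes> \<nu>"
      using split[of "{p..<q}" R g] IR I g far by auto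
    interpret V: subgroup "gen ({..<r} - {j})" G by (rule gen_sub) auto
    have pqr: "{p..<q} \<subseteq> {..<r}" "{0..<j} \<subseteq> {..<r}" "{Suc j..<r} \<subseteq> {..<r}"
      using qr jr by auto
    (* The factor \<nu> avoids j, so \<mu> = g \<nu>^-1 does, too. *)
    have carrs: "\<mu> \<in> carrier G" "\<nu> \<in> carrier G"
      using carr[OF pqr(1) mn(1)] carr[OF jR(2) mn(2)] by auto
    have "\<nu> \<in> gen ({..<r} - {j})" using mn gen_mono[of R "{..<r} - {j}"] jR by auto
    then have "g \<otimes> inv \<nu> \<in> gen ({..<r} - {j})" using g by auto
    then have "\<mu> \<in> gen ({..<r} - {j})" using mn carrs by (simp add: m_assoc)
    also have "{..<r} - {j} = {0..<j} \<union> {Suc j..<r}" using jr by auto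
    finally obtain \<gamma> \<delta> where gd: "\<gamma> \<in> gen {0..<j}" "\<delta> \<in> gen {Suc j..<r}" "\<mu> = \<gamma> \<otimes> \<delta>"
      using split[of "{0..<j}" "{Suc j..<r}" \<mu>] jr by fastforce
    have carrs2: "\<gamma> \<in> carrier G" "\<delta> \<in> carrier G"
      using carr[OF pqr(2) gd(1)] carr[OF pqr(3) gd(2)] by auto
    (* \<gamma> = \<mu> \<delta>^-1 needs only labels from p on, and \<delta> = \<gamma>^-1 \<mu> only labels below q. *)
    interpret Pr: subgroup "gen {p..<r}" G by (rule gen_sub) auto
    interpret Oq: subgroup "gen {0..<q}" G by (rule gen_sub) (use qr in auto)
    interpret Ij: subgroup "gen (I - {j})" G by (rule gen_sub) (use I in auto)
    have "\<mu> \<in> gen {p..<r}" "\<delta> \<in> gen {p..<r}"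
      using mn gd gen_mono[of "{p..<q}" "{p..<r}"] gen_mono[of "{Suc j..<r}" "{p..<r}"] pj qr by auto
    then have "\<mu> \<otimes> inv \<delta> \<in> gen {p..<r}" by auto
    then have "\<gamma> \<in> gen {p..<r}" using gd carrs2 by (simp add: m_assoc)
    with gd intervals[of 0 p j r] jr have "\<gamma> \<in> gen {p..<j}" by auto
    moreover have "\<mu> \<in> gen {0..<q}" "\<gamma> \<in> gen {0..<q}"
      using mn gd gen_mono[of "{p..<q}" "{0..<q}"] gen_mono[of "{0..<j}" "{0..<q}"] q by auto
    then have "inv \<gamma> \<otimes> \<mu> \<in> gen {0..<q}" by auto
    then have "\<delta> \<in> gen {0..<q}" using gd carrs2 by (simp add: m_assoc[symmetric])
    with gd intervals[of 0 "Suc j" q r] qr have "\<delta> \<in> gen {Suc j..<q}" by auto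
    ultimately have "\<gamma> \<in> gen (I - {j})" "\<delta> \<in> gen (I - {j})" "\<nu> \<in> gen (I - {j})"
      using gen_mono[of "{p..<j}" "I - {j}"] gen_mono[of "{Suc j..<q}" "I - {j}"]
        gen_mono[of R "I - {j}"] mn jR run q pj by (auto simp: IR subset_iff)
    then show "g \<in> gen (I - {j})" using mn gd by auto
  qed
  have "gen I \<inter> gen J = gen (I \<inter> J)" if I: "I \<subseteq> {..<r}" and J: "J \<subseteq> {..<r}" for I J
  proof
    have "gen I \<inter> gen J \<subseteq> gen (I - D)" if "finite D" "D \<subseteq> {..<r} - J" for D
      using that
    proof (induction D)
      case (insert d D)
      have eq: "I - insert d D = I - D - {d}" by auto
      show ?case
      proof (cases "d \<in> I - D")
        case True
        have "gen J \<subseteq> gen ({..<r} - {d})" using insert.prems J by (intro gen_mono) auto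
        with insert.IH insert.prems delete[of "I - D" d] True I show ?thesis
          unfolding eq by blast
      next
        case False
        then have "I - insert d D = I - D" by auto
        then show ?thesis using insert by simp
      qed
    qed auto
    from this[of "{..<r} - J"] have "gen I \<inter> gen J \<subseteq> gen (I - ({..<r} - J))" by auto
    moreover have "I - ({..<r} - J) = I \<inter> J" using I by auto
    ultimately show "gen I \<inter> gen J \<subseteq> gen (I \<inter> J)" by simp
    show "gen (I \<inter> J) \<subseteq> gen I \<inter> gen J" using gen_mono by auto
  qed
  then show ?thesis using s unfolding string_C_group_def gen_def by auto
qed


section \<open>Generated permutation groups\<close>

lemma symmetric_group_simps [simp]:
  "mult (symmetric_group \<Omega>) = (\<circ>)" "one (symmetric_group \<Omega>) = id"
  "p \<in> carrier (symmetric_group \<Omega>) \<longleftrightarrow> p permutes \<Omega>"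
  by (simp_all add: symmetric_group_def)

lemma inv_symmetric_group:
  assumes "p permutes \<Omega>"
  shows "m_inv (symmetric_group \<Omega>) p = inv_into UNIV p"
  using assms permutes_inv[OF assms] permutes_inv_o[OF assms]
  by (intro group.inv_equality[OF group_symmetric_group]) auto

lemma subgroup_symmetric_group_permutes:
  assumes "V \<subseteq> \<Omega>"
  shows "subgroup {p. p permutes V} (symmetric_group \<Omega>)"
proof (rule group.subgroupI[OF group_symmetric_group])
  show "{p. p permutes V} \<subseteq> carrier (symmetric_group \<Omega>)"
    using assms by (auto intro: permutes_subset)
  then show "m_inv (symmetric_group \<Omega>) p \<in> {p. p permutes V}" if "p \<in> {p. p permutes V}" for p
    using that by (auto simp: inv_symmetric_group permutes_inv subset_iff)
qed (auto intro: permutes_id permutes_compose)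

lemma generate_permutes:
  assumes "K \<subseteq> {p. p permutes V}" "V \<subseteq> \<Omega>" "g \<in> generate (symmetric_group \<Omega>) K"
  shows "g permutes V"
  using group.generate_subgroup_incl[OF group_symmetric_group assms(1)
      subgroup_symmetric_group_permutes[OF assms(2)]] assms(3)
  by auto

text \<open>On an invariant set that one family of generators fixes pointwise, only the other family is
  visible. This separates the action of a glued group on one side from its action on the other.
  The invariance of \<open>W\<close> under \<open>h\<close> is part of the conclusion because products need it.\<close>

lemma generate_agrees_on:
  assumes perm: "K \<union> L \<subseteq> {p. p permutes \<Omega>}"
    and fixed: "\<And>k x. k \<in> K \<Longrightarrow> x \<in> W \<Longrightarrow> k x = x"
    and inv: "\<And>l. l \<in> L \<Longrightarrow> l ` W = W"
    and g: "g \<in> generate (symmetric_group \<Omega>) (K \<union> L)"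
  shows "\<exists>h\<in>generate (symmetric_group \<Omega>) L. h ` W = W \<and> (\<forall>x\<in>W. g x = h x)"
  using g
proof (induction rule: generate.induct)
  case one
  show ?case by (intro bexI[of _ id]) (use generate.one[of "symmetric_group \<Omega>" L] in auto)
next
  case (incl h)
  then show ?case
  proof
    assume "h \<in> K"
    then show ?thesis
      by (intro bexI[of _ id]) (use fixed generate.one[of "symmetric_group \<Omega>" L] in auto)
  next
    assume "h \<in> L"
    then show ?thesis using assms(3)[of h] by (intro bexI[of _ h]) (auto intro: generate.incl)
  qed
next
  case (inv h)
  then have h: "h permutes \<Omega>" using perm by auto
  note [simp] = permutes_inverses[OF h] inv_symmetric_group[OF h]
  from inv show ?case
  proof
    assume "h \<in> K"
    then have "inv_into UNIV h x = x" if "x \<in> W" for x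
      using fixed that by (simp add: permutes_inv_eq[OF h])
    then show ?thesis
      by (intro bexI[of _ id]) (use generate.one[of "symmetric_group \<Omega>" L] in auto)
  next
    assume "h \<in> L"
    then have "inv_into UNIV h ` W = W" using assms(3)[of h]
      by (metis h image_inv_f_f permutes_inj)
    then show ?thesis
      using generate.inv[OF \<open>h \<in> L\<close>, of "symmetric_group \<Omega>"] by (intro bexI[of _ "inv_into UNIV h"]) auto
  qed
next
  case (eng h1 h2)
  then obtain k1 k2 where *: "k1 \<in> generate (symmetric_group \<Omega>) L" "k1 ` W = W" "\<forall>x\<in>W. h1 x = k1 x"
    "k2 \<in> generate (symmetric_group \<Omega>) L" "k2 ` W = W" "\<forall>x\<in>W. h2 x = k2 x"
    by blast
  then have "(k1 \<circ> k2) ` W = W" by (metis image_comp)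
  moreover have "\<forall>x\<in>W. (h1 \<circ> h2) x = (k1 \<circ> k2) x" using * by auto
  ultimately show ?case
    using generate.eng[OF *(1,4)] by (intro bexI[of _ "k1 \<circ> k2"]) auto
qed

text \<open>The only generator that moves points of \<open>V' - V\<close> is the involution \<open>\<sigma>\<close>. So outside \<open>v\<close> and \<open>\<sigma> v\<close>
  the permutation \<open>g\<close>, which fixes everything outside \<open>V'\<close>, agrees with a power of \<open>\<sigma>\<close>. The quotient of
  the two moves at most the points \<open>v\<close> and \<open>\<sigma> v\<close>, and it is trivial because it is even. This is how the evenness of the group
  replaces an intersection hypothesis at the two labels next to the common vertex.\<close>

lemma hinge_intersection:
  assumes V: "V \<subseteq> \<Omega>" "V' \<subseteq> \<Omega>" "V \<inter> V' = {v}"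
    and K: "K \<subseteq> {p. p permutes V}" and \<sigma>: "\<sigma> permutes V'" "\<sigma> \<circ> \<sigma> = id"
    and even: "\<And>g. g \<in> generate (symmetric_group \<Omega>) (insert \<sigma> K) \<Longrightarrow> evenperm g"
    and g: "g \<in> generate (symmetric_group \<Omega>) (insert \<sigma> K)" "g permutes V'"
  shows "g \<in> generate (symmetric_group \<Omega>) {\<sigma>}"
proof -
  interpret group "symmetric_group \<Omega>" by (rule group_symmetric_group)
  define W where "W = V' - {v, \<sigma> v}"
  have \<sigma>\<sigma>: "\<sigma> (\<sigma> x) = x" for x using \<sigma>(2) by (metis comp_apply id_apply)
  have perm: "K \<union> {\<sigma>} \<subseteq> {p. p permutes \<Omega>}" using K \<sigma> V by (auto intro: permutes_subset)
  have "k x = x" if "k \<in> K" "x \<in> W" for k x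
    using K V that permutes_not_in[of k V x] by (auto simp: W_def)
  moreover have "\<sigma> ` W = W"
  proof -
    have "\<sigma> x \<in> W" if "x \<in> W" for x
      using that \<sigma>\<sigma>[of x] \<sigma>\<sigma>[of v] permutes_in_image[OF \<sigma>(1), of x] unfolding W_def
      by (metis Diff_iff empty_iff insert_iff)
    then have "\<sigma> ` W \<subseteq> W" by blast
    then show ?thesis using \<sigma>\<sigma> by (metis (no_types, lifting) image_eqI image_subset_iff subsetI subset_antisym)
  qed
  moreover have "g \<in> generate (symmetric_group \<Omega>) (K \<union> {\<sigma>})" using g by simp
  ultimately obtain h where h: "h \<in> generate (symmetric_group \<Omega>) {\<sigma>}" "\<forall>x\<in>W. g x = h x"
    using generate_agrees_on[of K "{\<sigma>}" \<Omega> W g] perm by auto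
  have hV: "h permutes V'" using generate_permutes[of "{\<sigma>}" V' \<Omega> h] h \<sigma> V by auto
  have h\<Omega>: "h permutes \<Omega>" using hV V permutes_subset by blast
  define k where "k = inv_into UNIV h \<circ> g"
  have "inv_into UNIV h \<in> generate (symmetric_group \<Omega>) (insert \<sigma> K)"
    using generate_m_inv_closed[of "{\<sigma>}" h] h perm mono_generate[of "{\<sigma>}" "insert \<sigma> K"]
      inv_symmetric_group[OF h\<Omega>] by auto
  then have "k \<in> generate (symmetric_group \<Omega>) (insert \<sigma> K)"
    using generate.eng[OF _ g(1)] by (fastforce simp: k_def)
  then have "evenperm k" by (rule even)
  have "k permutes V'" unfolding k_def by (rule permutes_compose[OF g(2) permutes_inv[OF hV]])
  moreover have "k x = x" if "x \<in> W" for x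
    using h(2) that permutes_inverses[OF hV] by (simp add: k_def)
  ultimately have "k permutes {v, \<sigma> v}"
    by (rule permutes_superset) (auto simp: W_def)
  then have "k = id"
    using \<open>evenperm k\<close> by (auto simp: permutes_doubleton_iff evenperm_swap)
  then have "g = h"
    using permutes_inverses[OF hV] by (simp add: k_def fun_eq_iff) metis
  then show ?thesis using h by simp
qed

section \<open>A 3-cycle that propagates along an orbit\<close>

text \<open>Transpositions \<open>s\<close> and \<open>t\<close> are called equivalent when \<open>s \<circ> t \<in> C\<close>. The class of \<open>(v u)\<close> contains
  \<open>(v w)\<close> because of the 3-cycle, and it is closed under conjugation by its own members. It is also
  closed under conjugation by the generators: each of them fixes \<open>(v u)\<close> or \<open>(v w)\<close>, so it
  maps the class to itself. Hence the points that are joined to \<open>v\<close> by a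
  transposition of the class form, with \<open>v\<close>, a set that is invariant under \<open>C\<close> and so
  contains the orbit, and every transposition within that set lies in the class. An even
  permutation of the orbit is a product of pairs of such transpositions, each pair being in \<open>C\<close>.\<close>

lemma alternating_on_orbit:
  fixes \<Omega> R
  defines "C \<equiv> generate (symmetric_group \<Omega>) R"
  assumes fin: "finite \<Omega>" and v: "v \<in> \<Omega>"
    and R: "\<And>\<rho>. \<rho> \<in> R \<Longrightarrow> \<rho> permutes \<Omega>" "\<And>\<rho>. \<rho> \<in> R \<Longrightarrow> \<rho> \<circ> \<rho> = id"
    and neq: "v \<noteq> u" "v \<noteq> w" "u \<noteq> w"
    and cyc: "transpose v u \<circ> transpose v w \<in> C"
    and edge: "\<And>\<rho>. \<rho> \<in> R \<Longrightarrow> \<rho> ` {v, u} = {v, u} \<or> \<rho> ` {v, w} = {v, w}"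
    and p: "p permutes {h v | h. h \<in> C}" "evenperm p"
  shows "p \<in> C"
proof -
  interpret group "symmetric_group \<Omega>" by (rule group_symmetric_group)
  let ?\<tau> = "transpose v u" and ?\<tau>' = "transpose v w"
  define E where "E a b \<longleftrightarrow> ?\<tau> \<circ> transpose a b \<in> C" for a b
  have Rsub: "R \<subseteq> carrier (symmetric_group \<Omega>)" using R by auto
  have comp: "f \<circ> g \<in> C" if "f \<in> C" "g \<in> C" for f g
    using generate.eng[of f "symmetric_group \<Omega>" R g] that by (simp add: C_def)
  have perm: "f permutes \<Omega>" if "f \<in> C" for f
    using generate_in_carrier[OF Rsub] that by (simp add: C_def)
  have inv: "inv_into UNIV f \<in> C" if "f \<in> C" for f
    using generate_m_inv_closed[OF Rsub that[unfolded C_def]] inv_symmetric_group[OF perm[OF that]]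
    by (simp add: C_def)
  have RC: "\<rho> \<in> C" if "\<rho> \<in> R" for \<rho> using that by (simp add: C_def generate.incl)
  have flip: "transpose c d \<circ> transpose a b \<in> C" if "transpose a b \<circ> transpose c d \<in> C" for a b c d
  proof -
    have "inv_into UNIV (transpose a b \<circ> transpose c d) = transpose c d \<circ> transpose a b"
      by (rule inv_unique_comp) (auto simp: fun_eq_iff)
    then show ?thesis using inv[OF that] by simp
  qed
  have E_sym: "E b a" if "E a b" for a b using that by (simp add: E_def transpose_commute)
  have E_trans: "E a c" if "E a b" "E b c" "a \<noteq> c" "b \<noteq> c" for a b c
  proof -
    have "?\<tau> \<circ> transpose a b \<in> C" "transpose b c \<circ> ?\<tau> \<in> C"
      using that flip by (auto simp: E_def)
    then have "(?\<tau> \<circ> transpose a b) \<circ> (transpose b c \<circ> ?\<tau>) \<circ> (?\<tau> \<circ> transpose a b) \<in> C"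
      using comp by blast
    moreover have "(?\<tau> \<circ> transpose a b) \<circ> (transpose b c \<circ> ?\<tau>) \<circ> (?\<tau> \<circ> transpose a b)
        = ?\<tau> \<circ> transpose a c"
      using transpose_triple[OF that(3,4)] by (simp add: fun_eq_iff)
    ultimately show ?thesis by (simp only: E_def)
  qed
  have E_conj: "E (\<rho> a) (\<rho> b)" if "E a b" "\<rho> \<in> R" for a b \<rho>
  proof -
    have \<rho>\<rho>: "\<rho> (\<rho> x) = x" for x using R(2)[OF that(2)] by (metis comp_apply id_apply)
    have "bij \<rho>" using R(1)[OF that(2)] permutes_bij by blast
    moreover have "inv_into UNIV \<rho> = \<rho>" using R(2)[OF that(2)] inv_unique_comp by blast
    ultimately have tr: "transpose (\<rho> x) (\<rho> y) (\<rho> z) = \<rho> (transpose x y z)" for x y z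
      using transpose_apply_commute[of \<rho> "\<rho> x" "\<rho> y" z] \<rho>\<rho> by simp
    then have eq: "transpose (\<rho> a) (\<rho> b) = \<rho> \<circ> transpose a b \<circ> \<rho>"
      using \<rho>\<rho> by (metis (no_types, lifting) comp_apply ext)
    have t: "\<rho> \<in> C" using RC that by simp
    from edge[OF that(2)] show ?thesis
    proof
      assume "\<rho> ` {v, u} = {v, u}"
      then have "?\<tau> = transpose (\<rho> v) (\<rho> u)"
        by (auto simp: doubleton_eq_iff transpose_commute)
      then have "?\<tau> (\<rho> x) = \<rho> (?\<tau> x)" for x using tr by metis
      then have "?\<tau> \<circ> transpose (\<rho> a) (\<rho> b) = \<rho> \<circ> (?\<tau> \<circ> transpose a b) \<circ> \<rho>"
        by (simp add: eq fun_eq_iff)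
      then show ?thesis using that t comp by (simp add: E_def)
    next
      assume "\<rho> ` {v, w} = {v, w}"
      then have "?\<tau>' = transpose (\<rho> v) (\<rho> w)"
        by (auto simp: doubleton_eq_iff transpose_commute)
      then have "?\<tau>' (\<rho> x) = \<rho> (?\<tau>' x)" for x using tr by metis
      then have "?\<tau>' (\<rho> (?\<tau>' x)) = \<rho> x" for x by simp
      then have "?\<tau> \<circ> transpose (\<rho> a) (\<rho> b)
          = (?\<tau> \<circ> ?\<tau>') \<circ> \<rho> \<circ> (?\<tau>' \<circ> ?\<tau>) \<circ> (?\<tau> \<circ> transpose a b) \<circ> \<rho>"
        by (simp add: eq fun_eq_iff)
      also have "\<dots> \<in> C"
        by (rule comp[OF comp[OF comp[OF comp[OF cyc t] flip[OF cyc]] that(1)[unfolded E_def]] t])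
      finally show ?thesis by (simp add: E_def)
    qed
  qed
  have E_u: "E v u" using generate.one[of "symmetric_group \<Omega>" R] by (simp add: E_def C_def)
  have E_w: "E v w" using cyc by (simp add: E_def)
  define \<Delta> where "\<Delta> = {x. x = v \<or> E v x}"
  have pairs: "E a b" if "a \<in> \<Delta>" "b \<in> \<Delta>" "a \<noteq> b" for a b
    using that E_sym E_trans[of a v b] unfolding \<Delta>_def by auto
  have step: "\<rho> x \<in> \<Delta>" if "\<rho> \<in> R" "x \<in> \<Delta>" for \<rho> x
  proof -
    have "\<rho> v \<in> {v, u, w}" using edge[OF that(1)] by auto
    then have rv: "\<rho> v \<in> \<Delta>" using E_u E_w by (auto simp: \<Delta>_def)
    show ?thesis
    proof (cases "x = v \<or> \<rho> x = v \<or> \<rho> v = v \<or> \<rho> v = \<rho> x")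
      case True
      then show ?thesis using rv that E_conj[of v x \<rho>] by (auto simp: \<Delta>_def)
    next
      case False
      then show ?thesis
        using rv that E_conj[of v x \<rho>] E_trans[of v "\<rho> v" "\<rho> x"] by (auto simp: \<Delta>_def)
    qed
  qed
  have "\<forall>x\<in>\<Delta>. h x \<in> \<Delta>" if "h \<in> C" for h
    using that unfolding C_def
  proof (induction rule: generate.induct)
    case (inv h)
    have "inv_into UNIV h = h" using R(2)[OF inv] inv_unique_comp by blast
    then show ?case using step[OF inv] inv_symmetric_group[OF R(1)[OF inv]] by simp
  qed (use step in auto)
  then have orbit: "{h v | h. h \<in> C} \<subseteq> \<Delta>" by (auto simp: \<Delta>_def)
  have "{h v | h. h \<in> C} \<subseteq> \<Omega>" using perm v permutes_in_image by fastforce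
  then have "finite {h v | h. h \<in> C}" using fin finite_subset by blast
  (* The induction adds one transposition at a time, so odd permutations are carried
     along, corrected by the transposition (v u). *)
  with p(1) have "(evenperm p \<longrightarrow> p \<in> C) \<and> (\<not> evenperm p \<longrightarrow> ?\<tau> \<circ> p \<in> C)"
  proof (induction rule: permutes_induct)
    case id
    have "id \<in> C" using generate.one[of "symmetric_group \<Omega>" R] by (simp add: C_def)
    then show ?case by (metis evenperm_id)
  next
    case (swap a b q)
    let ?t = "transpose a b"
    have "E a b" using pairs swap orbit by blast
    then have 1: "?\<tau> \<circ> ?t \<in> C" "?t \<circ> ?\<tau> \<in> C" using flip by (auto simp: E_def)
    have "permutation q" using swap.hyps \<open>finite {h v | h. h \<in> C}\<close> permutes_imp_permutation by blast
    then have ev: "evenperm (?t \<circ> q) \<longleftrightarrow> \<not> evenperm q"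
      using swap.hyps by (simp add: evenperm_comp permutation_swap_id evenperm_swap)
    show ?case
    proof (cases "evenperm q")
      case True
      then have "?\<tau> \<circ> (?t \<circ> q) \<in> C" using swap.IH 1 comp unfolding o_assoc by blast
      then show ?thesis using ev True by blast
    next
      case False
      then have "(?t \<circ> ?\<tau>) \<circ> (?\<tau> \<circ> q) \<in> C" using swap.IH 1 comp by blast
      moreover have "(?t \<circ> ?\<tau>) \<circ> (?\<tau> \<circ> q) = ?t \<circ> q" by (simp add: fun_eq_iff)
      ultimately show ?thesis using ev False by metis
    qed
  qed
  then show ?thesis using p by simp
qed


section \<open>Groups glued at one vertex\<close>

text \<open>The intersection property for generators \<open>K \<union> L\<^sub>0\<close> and \<open>K\<^sub>0 \<union> L\<close>, where \<open>K\<close> acts on one side and \<open>L\<close> on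
  the other. The common generators \<open>K\<^sub>0 \<union> L\<^sub>0\<close> include one involution on each side that
  moves \<open>v\<close>, and so the group that they generate contains all even permutations of the orbit \<open>\<Delta>\<close> of \<open>v\<close>.
  Off \<open>\<Delta>\<close>, an element \<open>g\<close> of both groups agrees on \<open>V'\<close> with some \<open>h2\<close> generated by \<open>L\<^sub>0\<close> and on \<open>V\<close> with
  some \<open>h1\<close> generated by \<open>K\<^sub>0\<close>; the rest of \<open>g\<close> is an even permutation of \<open>\<Delta>\<close>.\<close>

lemma glue_intersection:
  fixes \<Omega>
  defines "gen \<equiv> generate (symmetric_group \<Omega>)"
  assumes fin: "finite \<Omega>" and V: "V \<union> V' = \<Omega>" "V \<inter> V' = {v}"
    and K: "K \<subseteq> {p. p permutes V}" "K\<^sub>0 \<subseteq> K" and L: "L \<subseteq> {p. p permutes V'}" "L\<^sub>0 \<subseteq> L"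
    and invol: "\<And>p. p \<in> K\<^sub>0 \<union> L\<^sub>0 \<Longrightarrow> p \<circ> p = id"
    and \<sigma>: "\<sigma> \<in> K\<^sub>0" "\<sigma> v \<noteq> v" and \<theta>: "\<theta> \<in> L\<^sub>0" "\<theta> v \<noteq> v"
    and stab: "\<And>p. p \<in> K\<^sub>0 \<union> L\<^sub>0 \<Longrightarrow> p \<noteq> \<sigma> \<Longrightarrow> p \<noteq> \<theta> \<Longrightarrow> p v = v"
    and even: "\<And>p. p \<in> gen (K \<union> L\<^sub>0) \<Longrightarrow> evenperm p"
    and g: "g \<in> gen (K \<union> L\<^sub>0)" "g \<in> gen (K\<^sub>0 \<union> L)"
  shows "g \<in> gen (K\<^sub>0 \<union> L\<^sub>0)"
proof -
  interpret group "symmetric_group \<Omega>" by (rule group_symmetric_group)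
  have vV: "v \<in> V" "v \<in> V'" "v \<in> \<Omega>" and disj: "x \<in> V \<Longrightarrow> x \<noteq> v \<Longrightarrow> x \<notin> V'" "x \<in> V' \<Longrightarrow> x \<noteq> v \<Longrightarrow> x \<notin> V" for x
    using V by auto
  have V\<Omega>: "V \<subseteq> \<Omega>" "V' \<subseteq> \<Omega>" using V by auto
  have permV: "p permutes V" if "p \<in> K" for p using K that by auto
  have permV': "p permutes V'" if "p \<in> L" for p using L that by auto
  have perm: "K \<union> L \<subseteq> {p. p permutes \<Omega>}" using permV permV' V\<Omega> by (auto intro: permutes_subset)
  have sub: "K\<^sub>0 \<union> L\<^sub>0 \<subseteq> carrier (symmetric_group \<Omega>)" using perm K L by auto
  have inv2: "p (p x) = x" if "p \<in> K\<^sub>0 \<union> L\<^sub>0" for p x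
    using invol[OF that] by (metis comp_apply id_apply)
  define C where "C = gen (K\<^sub>0 \<union> L\<^sub>0)"
  have comp: "f \<circ> h \<in> C" if "f \<in> C" "h \<in> C" for f h
    using generate.eng[of f "symmetric_group \<Omega>" _ h] that by (simp add: C_def gen_def)
  have C\<Omega>: "f permutes \<Omega>" if "f \<in> C" for f
    using generate_in_carrier[OF sub] that by (simp add: C_def gen_def)
  have inv: "inv_into UNIV f \<in> C" if "f \<in> C" for f
    using generate_m_inv_closed[OF sub that[unfolded C_def gen_def]] inv_symmetric_group[OF C\<Omega>[OF that]]
    by (simp add: C_def gen_def)
  have incl: "p \<in> C" if "p \<in> K\<^sub>0 \<union> L\<^sub>0" for p
    using that by (simp add: C_def gen_def generate.incl)
  have id: "id \<in> C" using generate.one[of "symmetric_group \<Omega>"] by (simp add: C_def gen_def)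
  define w u where "w = \<sigma> v" and "u = \<theta> v"
  have \<sigma>V: "\<sigma> permutes V" and \<theta>V: "\<theta> permutes V'" using permV permV' \<sigma> \<theta> K L by auto
  have wV: "w \<in> V" "w \<notin> V'" "w \<noteq> v" and uV: "u \<in> V'" "u \<notin> V" "u \<noteq> v"
    using permutes_in_image[OF \<sigma>V, of v] permutes_in_image[OF \<theta>V, of v] vV \<sigma> \<theta>
      disj(1)[of w] disj(2)[of u] by (auto simp: w_def u_def)
  have uw: "u \<noteq> w" using wV uV by auto
  have \<sigma>2: "\<sigma> (\<sigma> x) = x" and \<theta>2: "\<theta> (\<theta> x) = x" for x using inv2 \<sigma> \<theta> by auto
  have \<sigma>w: "\<sigma> w = v" "\<sigma> v = w" and \<theta>u: "\<theta> u = v" "\<theta> v = u" using \<sigma>2 \<theta>2 by (auto simp: w_def u_def)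
  have \<sigma>out: "\<sigma> x = x" if "x \<notin> V" for x using permutes_not_in[OF \<sigma>V that] .
  have \<theta>out: "\<theta> x = x" if "x \<notin> V'" for x using permutes_not_in[OF \<theta>V that] .
  (* The supports of \<sigma> and \<theta> meet only in v, so this is the 3-cycle v, w, u. *)
  have "(\<sigma> \<circ> \<theta> \<circ> \<sigma> \<circ> \<theta>) x = (transpose v u \<circ> transpose v w) x" for x
  proof -
    consider "x = v" | "x = u" | "x = w" | "x \<noteq> v" "x \<noteq> u" "x \<noteq> w" "x \<in> V" "x \<notin> V'"
      | "x \<noteq> v" "x \<noteq> u" "x \<noteq> w" "x \<notin> V"
      using disj by blast
    then show ?thesis
    proof cases
      case 4
      have "\<sigma> x \<noteq> v" using 4 \<sigma>2[of x] \<sigma>w by auto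
      moreover have "\<sigma> x \<in> V" using 4 permutes_in_image[OF \<sigma>V] by auto
      ultimately have "\<sigma> x \<notin> V'" using disj by blast
      then show ?thesis using 4 by (simp add: \<theta>out \<sigma>2)
    next
      case 5
      have "\<theta> x \<noteq> v" using 5 \<theta>2[of x] \<theta>u by auto
      then have "\<theta> x \<notin> V" using 5 disj permutes_in_image[OF \<theta>V, of x] permutes_not_in[OF \<theta>V, of x]
        by metis
      then show ?thesis using 5 by (simp add: \<sigma>out \<theta>2)
    qed (use \<sigma>w \<theta>u \<sigma>out[of u] \<theta>out[of w] wV uV uw in auto)
  qed
  then have "transpose v u \<circ> transpose v w = \<sigma> \<circ> \<theta> \<circ> \<sigma> \<circ> \<theta>" by auto
  also have "\<dots> \<in> C" using comp incl \<sigma> \<theta> by auto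
  finally have cyc: "transpose v u \<circ> transpose v w \<in> C" .
  have edge: "p ` {v, u} = {v, u} \<or> p ` {v, w} = {v, w}" if "p \<in> K\<^sub>0 \<union> L\<^sub>0" for p
  proof (cases "p = \<sigma> \<or> p = \<theta>")
    case True
    then show ?thesis using \<sigma>w \<theta>u by auto
  next
    case False
    then have "p v = v" using stab that by auto
    moreover have "p u = u \<or> p w = w"
      using that permutes_not_in[OF permV, of p u] permutes_not_in[OF permV', of p w] wV uV K L
      by auto
    ultimately show ?thesis by auto
  qed
  define \<Delta> where "\<Delta> = {h v | h. h \<in> C}"
  have alt: "p \<in> C" if "p permutes \<Delta>" "evenperm p" for p
    unfolding C_def gen_def
    by (rule alternating_on_orbit[OF fin vV(3), of "K\<^sub>0 \<union> L\<^sub>0" u w])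
      (use sub invol wV uV uw cyc edge that in \<open>auto simp: C_def \<Delta>_def gen_def\<close>)
  have v\<Delta>: "v \<in> \<Delta>" using id by (auto simp: \<Delta>_def intro!: exI[of _ id])
  have \<Delta>: "h x \<in> \<Delta>" if "h \<in> C" "x \<in> \<Delta>" for h x
    using that comp unfolding \<Delta>_def by (smt (verit) comp_apply mem_Collect_eq)
  have diff: "p ` (U - \<Delta>) = U - \<Delta>" if p: "p \<in> K\<^sub>0 \<union> L\<^sub>0" "p permutes U" for p U
  proof -
    have "p x \<in> U - \<Delta>" if "x \<in> U - \<Delta>" for x
      using that permutes_in_image[OF p(2), of x] \<Delta>[OF incl[OF p(1)], of "p x"] inv2[OF p(1), of x]
      by auto
    then show ?thesis
      using inv2[OF p(1)] by (metis (no_types, lifting) image_eqI image_subsetI subsetI subset_antisym)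
  qed
  obtain h2 where h2: "h2 \<in> gen L\<^sub>0" "h2 ` (V' - \<Delta>) = V' - \<Delta>" "\<forall>x\<in>V' - \<Delta>. g x = h2 x"
  proof -
    have f1: "k x = x" if "k \<in> K" "x \<in> V' - \<Delta>" for k x
      using that permutes_not_in[OF permV[OF that(1)], of x] disj v\<Delta> by auto
    have f2: "l ` (V' - \<Delta>) = V' - \<Delta>" if "l \<in> L\<^sub>0" for l
      using diff[of l V'] permV'[of l] that L by blast
    have f3: "K \<union> L\<^sub>0 \<subseteq> {p. p permutes \<Omega>}" using perm L by auto
    have "\<exists>h\<in>generate (symmetric_group \<Omega>) L\<^sub>0. h ` (V' - \<Delta>) = V' - \<Delta> \<and> (\<forall>x\<in>V' - \<Delta>. g x = h x)"
      by (rule generate_agrees_on; fact f1 f2 f3 g(1)[unfolded gen_def])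
    then show ?thesis using that unfolding gen_def by blast
  qed
  obtain h1 where h1: "h1 \<in> gen K\<^sub>0" "h1 ` (V - \<Delta>) = V - \<Delta>" "\<forall>x\<in>V - \<Delta>. g x = h1 x"
  proof -
    have f1: "k x = x" if "k \<in> L" "x \<in> V - \<Delta>" for k x
      using that permutes_not_in[OF permV'[OF that(1)], of x] disj v\<Delta> by auto
    have f2: "l ` (V - \<Delta>) = V - \<Delta>" if "l \<in> K\<^sub>0" for l
      using diff[of l V] permV[of l] that K by blast
    have f3: "L \<union> K\<^sub>0 \<subseteq> {p. p permutes \<Omega>}" using perm K by auto
    have g': "g \<in> generate (symmetric_group \<Omega>) (L \<union> K\<^sub>0)" using g(2) by (simp add: gen_def Un_commute)
    have "\<exists>h\<in>generate (symmetric_group \<Omega>) K\<^sub>0. h ` (V - \<Delta>) = V - \<Delta> \<and> (\<forall>x\<in>V - \<Delta>. g x = h x)"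
      by (rule generate_agrees_on; fact f1 f2 f3 g')
    then show ?thesis using that unfolding gen_def by blast
  qed
  have h1V: "h1 permutes V" and h2V: "h2 permutes V'"
    using generate_permutes[of K\<^sub>0 V \<Omega> h1] generate_permutes[of L\<^sub>0 V' \<Omega> h2] h1 h2 K L V\<Omega>
    by (auto simp: gen_def)
  have hC: "h1 \<in> C" "h2 \<in> C"
    using h1 h2 mono_generate[of K\<^sub>0 "K\<^sub>0 \<union> L\<^sub>0"] mono_generate[of L\<^sub>0 "K\<^sub>0 \<union> L\<^sub>0"]
    by (auto simp: gen_def C_def)
  define k where "k = inv_into UNIV h1 \<circ> inv_into UNIV h2 \<circ> g"
  have CKL: "C \<subseteq> gen (K \<union> L\<^sub>0)"
    unfolding C_def gen_def using K by (intro mono_generate) auto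
  have "inv_into UNIV h1 \<circ> inv_into UNIV h2 \<in> gen (K \<union> L\<^sub>0)"
    using CKL comp inv hC by blast
  then have k: "k \<in> gen (K \<union> L\<^sub>0)"
    using generate.eng[of _ "symmetric_group \<Omega>" "K \<union> L\<^sub>0" g] g(1) by (simp add: k_def gen_def)
  then have "evenperm k" by (rule even)
  moreover have "k permutes \<Delta>"
  proof (rule permutes_superset)
    show "k permutes \<Omega>"
      using generate_permutes[of "K \<union> L\<^sub>0" \<Omega> \<Omega> k] k perm L by (auto simp: gen_def)
    fix x assume x: "x \<in> \<Omega> - \<Delta>"
    then consider "x \<in> V - \<Delta>" | "x \<in> V' - \<Delta>" using V by auto
    then show "k x = x"
    proof cases
      case 1
      then have "g x = h1 x" "h1 x \<in> V - \<Delta>" using h1 by auto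
      then have "inv_into UNIV h2 (g x) = h1 x"
        using permutes_not_in[OF permutes_inv[OF h2V], of "h1 x"] disj v\<Delta> by auto
      then show ?thesis using permutes_inverses[OF h1V] by (simp add: k_def)
    next
      case 2
      then have "inv_into UNIV h2 (g x) = x" using h2(3) permutes_inverses[OF h2V] by simp
      moreover have "x \<notin> V" using 2 disj v\<Delta> by auto
      ultimately show ?thesis
        using permutes_not_in[OF permutes_inv[OF h1V], of x] by (simp add: k_def)
    qed
  qed
  ultimately have "h2 \<circ> (h1 \<circ> k) \<in> C" using alt comp hC by blast
  moreover have "h2 \<circ> (h1 \<circ> k) = g"
    using permutes_inverses[OF h1V] permutes_inverses[OF h2V] by (simp add: k_def fun_eq_iff)
  ultimately show ?thesis by (simp add: C_def)
qed

text \<open>Labels below \<open>m\<close> occur only on edges of the first subgraph, so these generators are supported on its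
  vertices, and likewise for the second. If \<open>\<rho>\<^sub>k\<close> and \<open>\<rho>\<^sub>l\<close> from different sides both move \<open>v\<close>,
  then \<open>\<rho>\<^sub>k \<rho>\<^sub>l\<close> and \<open>\<rho>\<^sub>l \<rho>\<^sub>k\<close> send \<open>v\<close> to different sides; so they do not commute, and \<open>k\<close> and \<open>l\<close> are
  consecutive, that is, \<open>k = m - 1\<close> and \<open>l = m\<close>. Since \<open>v\<close> has a neighbour in both subgraphs, these two
  generators do move \<open>v\<close>.\<close>

lemma glued_sggiE:
  assumes glued: "glued_sggi \<Omega> \<Gamma> r m \<rho>"
  obtains V V' v where "V \<union> V' = \<Omega>" "V \<inter> V' = {v}" "0 < m"
    "\<And>i. i < m \<Longrightarrow> \<rho> i permutes V" "\<And>i. m \<le> i \<Longrightarrow> i < r \<Longrightarrow> \<rho> i permutes V'"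
    "\<rho> (m - 1) v \<noteq> v" "\<rho> m v \<noteq> v"
    "\<And>i. i < r \<Longrightarrow> i \<noteq> m - 1 \<Longrightarrow> i \<noteq> m \<Longrightarrow> \<rho> i v = v"
    "\<And>i. i < r \<Longrightarrow> \<rho> i \<circ> \<rho> i = id"
proof -
  let ?G = "perm_rep_graph \<Omega> r \<rho>"
  have s: "sggi \<Gamma> r \<rho>" and mr: "m < r" and pg: "permutation_group \<Omega> \<Gamma>"
    using glued by (auto simp: glued_sggi_def)
  from pg obtain H where H: "subgroup H (symmetric_group \<Omega>)" "\<Gamma> = (symmetric_group \<Omega>)\<lparr>carrier := H\<rparr>"
    by (auto simp: permutation_group_def)
  have perm: "\<rho> i permutes \<Omega>" if "i < r" for i
    using sggi_involution(1)[OF s that] subgroup.mem_carrier[OF H(1)] H(2) by auto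
  have invol: "\<rho> i \<circ> \<rho> i = id" if "i < r" for i
    using sggi_involution(2)[OF s that] H(2) by simp
  have comm: "\<rho> i \<circ> \<rho> j = \<rho> j \<circ> \<rho> i" if "i + 2 \<le> j" "j < r" for i j
    using sggi_commute[OF s, of i j] that H(2) by simp
  from glued obtain H1 H2 v where sub: "is_subgraph H1 ?G" "is_subgraph H2 ?G"
    and un: "?G = graph_union H1 H2" and vs: "verts H1 \<inter> verts H2 = {v}"
    and lab: "\<forall>(e, i)\<in>edges H1. i < m" "\<forall>(e, i)\<in>edges H2. m \<le> i \<and> i < r"
    and adj: "\<exists>w\<in>verts H1. w \<noteq> v \<and> adjacent H1 v w" "\<exists>w\<in>verts H2. w \<noteq> v \<and> adjacent H2 v w"
    unfolding glued_sggi_def by blast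
  have verts: "verts H1 \<union> verts H2 = \<Omega>"
    using arg_cong[OF un, of verts] by (simp add: perm_rep_graph_def graph_union_def)
  have edges: "edges H1 \<union> edges H2 = edges ?G"
    using arg_cong[OF un, of edges] by (simp add: graph_union_def)
  have moved: "(i < m \<and> x \<in> verts H1) \<or> (m \<le> i \<and> x \<in> verts H2)"
    if "i < r" "\<rho> i x \<noteq> x" for i x
  proof -
    have "x \<in> \<Omega>" using that permutes_not_in[OF perm[OF that(1)], of x] by blast
    then have "\<rho> i x \<in> \<Omega>" by (rule permutes_in_image[OF perm[OF that(1)], THEN iffD2])
    with \<open>x \<in> \<Omega>\<close> that have "({x, \<rho> i x}, i) \<in> edges ?G"
      unfolding perm_rep_graph_def labeled_multigraph.simps
      by (intro CollectI exI[of _ x] exI[of _ "\<rho> i x"] exI[of _ i] conjI refl) (simp_all (no_asm_simp) add: eq_commute)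
    then have "({x, \<rho> i x}, i) \<in> edges H1 \<or> ({x, \<rho> i x}, i) \<in> edges H2" using edges by blast
    moreover have "x \<in> verts H1 \<and> i < m" if "({x, \<rho> i x}, i) \<in> edges H1"
      using that sub(1) lab(1) unfolding is_subgraph_def by blast
    moreover have "x \<in> verts H2 \<and> m \<le> i" if "({x, \<rho> i x}, i) \<in> edges H2"
      using that sub(2) lab(2) unfolding is_subgraph_def by blast
    ultimately show ?thesis by blast
  qed
  have p1: "\<rho> i permutes verts H1" if "i < m" for i
    by (rule permutes_superset[OF perm]) (use that mr moved[of i] in force)+
  have p2: "\<rho> i permutes verts H2" if "m \<le> i" "i < r" for i
    by (rule permutes_superset[OF perm]) (use that mr moved[of i] in force)+
  have label: "\<exists>i. i < r \<and> ({v, w}, i) \<in> edges H \<and> \<rho> i v = w"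
    if "adjacent H v w" "edges H \<subseteq> edges ?G" for H w
  proof -
    from that obtain i where i: "({v, w}, i) \<in> edges H" by (auto simp: adjacent_def)
    with that have "({v, w}, i) \<in> edges ?G" by blast
    then have ir: "i < r" and "\<rho> i v = w \<or> \<rho> i w = v"
      by (auto simp: perm_rep_graph_def doubleton_eq_iff)
    then show ?thesis using i invol[OF ir] by (metis comp_apply id_apply)
  qed
  have sub_edges: "edges H1 \<subseteq> edges ?G" "edges H2 \<subseteq> edges ?G" using edges by auto
  obtain w where w: "w \<in> verts H1" "w \<noteq> v" "adjacent H1 v w" using adj(1) by blast
  obtain i where i: "i < m" "\<rho> i v \<noteq> v"
    using label[OF w(3) sub_edges(1)] w(2) lab(1) by blast
  obtain u where u: "u \<in> verts H2" "u \<noteq> v" "adjacent H2 v u" using adj(2) by blast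
  obtain j where j: "m \<le> j" "j < r" "\<rho> j v \<noteq> v"
    using label[OF u(3) sub_edges(2)] u(2) lab(2) by blast
  have adjacent_labels: "l = Suc k"
    if kl: "k < m" "m \<le> l" "l < r" "\<rho> k v \<noteq> v" "\<rho> l v \<noteq> v" for k l
  proof (rule ccontr)
    assume "l \<noteq> Suc k"
    with kl comm[of k l] have eq: "\<rho> k (\<rho> l v) = \<rho> l (\<rho> k v)"
      by (metis Suc_leI add_2_eq_Suc' comp_apply le_neq_implies_less le_trans less_eq_Suc_le)
    have "v \<in> verts H1" "v \<in> verts H2" using vs by auto
    then have "\<rho> k v \<in> verts H1" "\<rho> l v \<in> verts H2"
      using permutes_in_image[OF p1[OF kl(1)]] permutes_in_image[OF p2[OF kl(2,3)]] by auto
    then have "\<rho> k v \<notin> verts H2" "\<rho> l v \<notin> verts H1" using vs kl by blast+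
    then have "\<rho> l v = \<rho> k v"
      using eq permutes_not_in[OF p1[OF kl(1)]] permutes_not_in[OF p2[OF kl(2,3)]] by metis
    then show False using \<open>\<rho> k v \<notin> verts H2\<close> \<open>\<rho> l v \<in> verts H2\<close> by simp
  qed
  have ij: "i = m - 1" "j = m" "0 < m" using adjacent_labels[of i j] i j by auto
  have fixes_v: "\<rho> k v = v" if "k < r" "k \<noteq> m - 1" "k \<noteq> m" for k
    using that adjacent_labels[of k m] adjacent_labels[of "m - 1" k] i j ij mr
    by (cases "k < m"; force)
  show ?thesis
    by (rule that[of "verts H1" "verts H2" v]) (use verts vs ij p1 p2 i j fixes_v invol in auto)
qed

section \<open>The glued string C-group\<close>

theorem theorem3p9:
  fixes \<Omega> :: "'a set" and \<Gamma> :: "('a \<Rightarrow> 'a) monoid"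
    and r m :: nat and \<rho> :: "nat \<Rightarrow> 'a \<Rightarrow> 'a"
  assumes "even_permutation_group \<Omega> \<Gamma>"
    and "glued_sggi_string_C_pieces \<Omega> \<Gamma> r m \<rho>"
    and "\<And>i. 1 \<le> i \<Longrightarrow> i + 2 \<le> m \<Longrightarrow>
           generate \<Gamma> (\<rho> ` {0..<m}) \<inter> generate \<Gamma> (\<rho> ` {i..<r}) = generate \<Gamma> (\<rho> ` {i..<m})"
    and "\<And>j. m + 1 \<le> j \<Longrightarrow> j + 2 \<le> r \<Longrightarrow>
           generate \<Gamma> (\<rho> ` {m..<r}) \<inter> generate \<Gamma> (\<rho> ` {0..j}) = generate \<Gamma> (\<rho> ` {m..j})"
  shows "string_C_group \<Gamma> r \<rho>"
proof -
  let ?S = "symmetric_group \<Omega>"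
  interpret S: group ?S by (rule group_symmetric_group)
  have glued: "glued_sggi \<Omega> \<Gamma> r m \<rho>"
    and piece1: "string_C_group (subgroup_generated \<Gamma> (\<rho> ` {..<m})) m \<rho>"
    and piece2: "string_C_group (subgroup_generated \<Gamma> (\<rho> ` {m..<r})) (r - m) (\<lambda>i. \<rho> (m + i))"
    using assms(2) by (auto simp: glued_sggi_string_C_pieces_def)
  have s: "sggi \<Gamma> r \<rho>" and mr: "m < r" and fin: "finite \<Omega>"
    using glued by (auto simp: glued_sggi_def permutation_group_def)
  interpret group \<Gamma> using s by (simp add: sggi_def)
  obtain H where H: "subgroup H ?S" "\<Gamma> = ?S\<lparr>carrier := H\<rparr>"
    using glued by (auto simp: glued_sggi_def permutation_group_def)
  have img: "\<rho> ` I \<subseteq> carrier \<Gamma>" if "I \<subseteq> {..<r}" for I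
    using that sggi_involution(1)[OF s] by auto
  have gen_eq: "generate \<Gamma> (\<rho> ` I) = generate ?S (\<rho> ` I)" if "I \<subseteq> {..<r}" for I
    using S.generate_consistent[OF _ H(1), of "\<rho> ` I"] img[OF that] H(2) by simp
  have gen_eq_ivl: "generate \<Gamma> (\<rho> ` {x..<y}) = generate ?S (\<rho> ` {x..<y})" if "y \<le> r" for x y
    using that by (intro gen_eq) auto
  have even: "evenperm p" if "p \<in> generate ?S (\<rho> ` I)" "I \<subseteq> {..<r}" for p I
    using assms(1) that generate_in_carrier[OF img[OF that(2)]] gen_eq[OF that(2)]
    by (auto simp: even_permutation_group_def)
  have gen_mono: "generate \<Gamma> (\<rho> ` {x..<y}) \<subseteq> generate \<Gamma> (\<rho> ` {x'..<y'})"
    if "x' \<le> x" "y \<le> y'" for x y x' y'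
    using that by (intro mono_generate image_mono) auto
  have gen_piece: "generate (subgroup_generated \<Gamma> (\<rho> ` J)) (\<rho> ` I) = generate \<Gamma> (\<rho> ` I)"
    if "I \<subseteq> J" "J \<subseteq> {..<r}" for I J
  proof -
    have eq: "carrier \<Gamma> \<inter> \<rho> ` J = \<rho> ` J" using img[OF that(2)] by auto
    have "\<rho> ` I \<subseteq> generate \<Gamma> (\<rho> ` J)" using that by (auto intro: generate.incl)
    then show ?thesis
      unfolding subgroup_generated_def eq
      by (rule generate_consistent[OF _ generate_is_subgroup[OF img[OF that(2)]]])
  qed
  obtain V V' v where V: "V \<union> V' = \<Omega>" "V \<inter> V' = {v}" "0 < m"
    and left: "\<And>i. i < m \<Longrightarrow> \<rho> i permutes V" and right: "\<And>i. m \<le> i \<Longrightarrow> i < r \<Longrightarrow> \<rho> i permutes V'"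
    and mv: "\<rho> (m - 1) v \<noteq> v" "\<rho> m v \<noteq> v"
    and fixes_v: "\<And>i. i < r \<Longrightarrow> i \<noteq> m - 1 \<Longrightarrow> i \<noteq> m \<Longrightarrow> \<rho> i v = v"
    and invol: "\<And>i. i < r \<Longrightarrow> \<rho> i \<circ> \<rho> i = id"
    by (rule glued_sggiE[OF glued]) blast
  have V\<Omega>: "V \<subseteq> \<Omega>" "V' \<subseteq> \<Omega>" using V by auto
  show ?thesis
  proof (rule string_C_groupI[OF s], rule subsetI, elim IntE)
    fix a b g
    assume ab: "a < b" "b < r" and g: "g \<in> generate \<Gamma> (\<rho> ` {a..<b})" "g \<in> generate \<Gamma> (\<rho> ` {Suc a..<Suc b})"
    have gS: "g \<in> generate ?S (\<rho> ` {a..<b})" "g \<in> generate ?S (\<rho> ` {Suc a..<Suc b})"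
      using g gen_eq_ivl[of b a] gen_eq_ivl[of "Suc b" "Suc a"] ab by auto
    consider (first) "b < m" | (second) "m \<le> a"
      | (hinge) "a = m - 1" "b = m"
      | (hinge_up) "a = m - 1" "b = Suc m" | (up) "a = m - 1" "Suc m < b"
      | (hinge_down) "Suc (Suc a) = m" "b = m" | (down) "Suc (Suc a) < m" "b = m"
      | (glue) "Suc a < m" "m < b"
      using ab V(3) by linarith
    then show "g \<in> generate \<Gamma> (\<rho> ` {Suc a..<b})"
    proof cases
      case first
      let ?I = "{a..<b}" and ?J = "{Suc a..<Suc b}"
      have sub: "?I \<subseteq> {..<m}" "?J \<subseteq> {..<m}" "?I \<inter> ?J \<subseteq> {..<m}"
        using first mr by auto
      have le: "{..<m} \<subseteq> {..<r}" using mr by auto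
      from sub piece1 have "generate \<Gamma> (\<rho> ` ?I) \<inter> generate \<Gamma> (\<rho> ` ?J) = generate \<Gamma> (\<rho> ` (?I \<inter> ?J))"
        unfolding string_C_group_def by (metis gen_piece le)
      moreover have "?I \<inter> ?J = {Suc a..<b}" by auto
      ultimately show ?thesis using g by auto
    next
      case second
      let ?I = "{a - m..<b - m}" and ?J = "{Suc a - m..<Suc b - m}"
      have shift: "(\<lambda>i. \<rho> (m + i)) ` {x - m..<y - m} = \<rho> ` {x..<y}" if "m \<le> x" "m \<le> y" for x y
      proof -
        have "(\<lambda>i. m + i) ` {x - m..<y - m} = {x..<y}" using that by (simp add: image_add_atLeastLessThan)
        then show ?thesis by (metis image_image)
      qed
      have "?I \<inter> ?J = {Suc a - m..<b - m}" "?I \<subseteq> {..<r - m}" "?J \<subseteq> {..<r - m}"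
        using second ab by auto
      with piece2 have "generate (subgroup_generated \<Gamma> (\<rho> ` {m..<r})) ((\<lambda>i. \<rho> (m + i)) ` ?I)
          \<inter> generate (subgroup_generated \<Gamma> (\<rho> ` {m..<r})) ((\<lambda>i. \<rho> (m + i)) ` ?J)
          = generate (subgroup_generated \<Gamma> (\<rho> ` {m..<r})) ((\<lambda>i. \<rho> (m + i)) ` {Suc a - m..<b - m})"
        unfolding string_C_group_def by metis
      moreover have "(\<lambda>i. \<rho> (m + i)) ` ?I = \<rho> ` {a..<b}"
          "(\<lambda>i. \<rho> (m + i)) ` ?J = \<rho> ` {Suc a..<Suc b}"
          "(\<lambda>i. \<rho> (m + i)) ` {Suc a - m..<b - m} = \<rho> ` {Suc a..<b}"
        using second ab by (intro shift; linarith)+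
      moreover have "generate (subgroup_generated \<Gamma> (\<rho> ` {m..<r})) (\<rho> ` {x..<y}) = generate \<Gamma> (\<rho> ` {x..<y})"
        if "m \<le> x" "y \<le> r" for x y
        using that by (intro gen_piece) auto
      ultimately show ?thesis using g second ab by auto
    next
      case hinge
      have "g permutes V" by (rule generate_permutes[OF _ V\<Omega>(1) gS(1)]) (use hinge left V(3) in auto)
      moreover have "g permutes V'" by (rule generate_permutes[OF _ V\<Omega>(2) gS(2)]) (use hinge right V(3) ab in auto)
      ultimately have "g permutes {v}"
        using V(2) permutes_not_in[of g V'] by (elim permutes_superset) blast
      then have "g = \<one>\<^bsub>\<Gamma>\<^esub>" using permutes_sing[of g v] H(2) by simp
      then show ?thesis by (simp add: generate.one)
    next
      case hinge_up
      have ivl: "{a..<b} = {m, m - 1}" "{Suc a..<b} = {m}" using hinge_up V(3) by auto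
      have "g \<in> generate ?S {\<rho> m}"
      proof (rule hinge_intersection[OF V\<Omega> V(2), of "{\<rho> (m - 1)}"])
        show "g permutes V'" by (rule generate_permutes[OF _ V\<Omega>(2) gS(2)]) (use hinge_up right V(3) ab in auto)
        show "evenperm p" if "p \<in> generate ?S {\<rho> m, \<rho> (m - 1)}" for p
          using even[of p "{m, m - 1}"] that mr by auto
      qed (use left right V(3) mr invol gS(1) in \<open>auto simp: ivl\<close>)
      then show ?thesis using gen_eq[of "{m}"] mr by (simp add: ivl)
    next
      case hinge_down
      have ivl: "{Suc a..<Suc b} = {m - 1, m}" "{Suc a..<b} = {m - 1}" using hinge_down by auto
      have "g \<in> generate ?S {\<rho> (m - 1)}"
      proof (rule hinge_intersection[OF V\<Omega>(2,1), of v "{\<rho> m}"])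
        show "g permutes V" by (rule generate_permutes[OF _ V\<Omega>(1) gS(1)]) (use hinge_down left in auto)
        show "evenperm p" if "p \<in> generate ?S {\<rho> (m - 1), \<rho> m}" for p
          using even[of p "{m - 1, m}"] that mr by auto
      qed (use left right V mr invol gS(2) in \<open>auto simp: ivl\<close>)
      then show ?thesis using gen_eq[of "{m - 1}"] mr by (simp add: ivl)
    next
      case up
      have eq: "{0..b - 1} = {0..<b}" using up by auto
      have "g \<in> generate \<Gamma> (\<rho> ` {m..<r})" "g \<in> generate \<Gamma> (\<rho> ` {0..b - 1})"
        unfolding eq using g gen_mono[of m "Suc a" "Suc b" r] gen_mono[of 0 a b b] up ab V(3)
        by auto
      moreover have "m + 1 \<le> b - 1" "b - 1 + 2 \<le> r" using up ab by auto
      ultimately have "g \<in> generate \<Gamma> (\<rho> ` {m..b - 1})" using assms(4) by blast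
      moreover have "{m..b - 1} = {Suc a..<b}" using up V(3) by auto
      ultimately show ?thesis by simp
    next
      case down
      have "g \<in> generate \<Gamma> (\<rho> ` {0..<m})" "g \<in> generate \<Gamma> (\<rho> ` {Suc a..<r})"
        using g gen_mono[of "Suc a" "Suc a" "Suc b" r] gen_mono[of 0 a b m] down ab
        by auto
      with assms(3)[of "Suc a"] down show ?thesis by auto
    next
      case glue
      have ivl: "{x..<m} \<union> {m..<y} = {x..<y}" if "x \<le> m" "m \<le> y" for x y :: nat
        using that by auto
      have un: "\<rho> ` {x..<m} \<union> \<rho> ` {m..<y} = \<rho> ` {x..<y}" if "x \<le> m" "m \<le> y" for x y :: nat
        using ivl[OF that] by (metis image_Un)
      have "g \<in> generate ?S (\<rho> ` {Suc a..<m} \<union> \<rho> ` {m..<b})"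
      proof (rule glue_intersection[OF fin V(1,2),
            of "\<rho> ` {a..<m}" _ "\<rho> ` {m..<Suc b}" _ "\<rho> (m - 1)" "\<rho> m"])
        show "evenperm p" if "p \<in> generate ?S (\<rho> ` {a..<m} \<union> \<rho> ` {m..<b})" for p
        proof (rule even)
          show "p \<in> generate ?S (\<rho> ` {a..<b})" using that glue un[of a b] by simp
        qed (use ab in auto)
        show "g \<in> generate ?S (\<rho> ` {a..<m} \<union> \<rho> ` {m..<b})" using gS(1) un[of a b] glue by simp
        show "g \<in> generate ?S (\<rho> ` {Suc a..<m} \<union> \<rho> ` {m..<Suc b})"
          using gS(2) un[of "Suc a" "Suc b"] glue by simp
        show "p v = v" if "p \<in> \<rho> ` {Suc a..<m} \<union> \<rho> ` {m..<b}" "p \<noteq> \<rho> (m - 1)" "p \<noteq> \<rho> m" for p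
        proof -
          have "p \<in> \<rho> ` {Suc a..<b}" using that(1) un[of "Suc a" b] glue by simp
          then obtain i where i: "i < b" "p = \<rho> i" by auto
          with that(2,3) have "i \<noteq> m - 1" "i \<noteq> m" by auto
          then show ?thesis using fixes_v[of i] i ab by simp
        qed
      qed (use left right mv invol glue ab mr in auto)
      then show ?thesis using gen_eq_ivl[of b "Suc a"] un[of "Suc a" b] glue ab by auto
    qed
  qed
qed

end
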